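(* Let $n\ge 2$ be an integer, $A$ an LM$_n$-algebra, and $X(A)$ its prime filter space with maps $f_1^A,\dots,f_{n-1}^A$. Then: (i) the lattice $\mathcal{C}_M(X(A))$ of all closed and modal subsets of $X(A)$ is isomorphic to the dual of the lattice $Con(A)$ of all congruences of $A$, via $Y\mapsto\Theta_M(Y)=\{(a,b)\in A\times A:\sigma_A(a)\cap Y=\sigma_A(b)\cap Y\}$; (ii) the lattice $\mathcal{O}_M(X(A))$ of all open and modal subsets of $X(A)$ is isomorphic to $Con(A)$, via $G\mapsto\Theta_{OM}(G)=\{(a,b)\in A\times A:\sigma_A(b)\triangle\sigma_A(a)\subseteq G\}$.
   Context: An LM$_n$-algebra ($n$-valued Łukasiewicz–Moisil algebra without negation) is an algebra $\langle A,\vee,\wedge,0,1,\{\phi_i\}_{i=1}^{n-1},\{\overline{\phi}_i\}_{i=1}^{n-1}\rangle$ with $\langle A,\vee,\wedge,0,1\rangle$ a bounded distributive lattice such that for all $i,j\in\{1,\dots,n-1\}$, $x,y\in A$: $\phi_i$ is a bounded lattice endomorphism; $\phi_i x\vee\overline{\phi}_i x=1$, $\phi_i x\wedge\overline{\phi}_i x=0$; $\phi_i\phi_j x=\phi_j x$; $i\le j$ implies $\phi_i x\le\phi_j x$; $\phi_i x=\phi_i y$ for all $i$ implies $x=y$. $X(A)$ is the set of prime filters of $A$ ordered by inclusion, with the topology having subbasis $\sigma_A(a)=\{P:a\in P\}$, $X(A)\setminus\sigma_A(a)$ ($a\in A$); $f_i^A(P)=\phi_i^{-1}(P)$. A subset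 $Y\subseteq X(A)$ is modal if $Y=(f_i^A)^{-1}(Y)$ for all $i$. *)

theory Defs
  imports "HOL-Algebra.Lattice" "HOL-Analysis.Abstract_Topology"
begin

text \<open>
  The bounded lattice reduct is given, as usual in \<open>HOL-Algebra\<close>, by its carrier and order; joins,
  meets and bounds are derived from the order. The fields \<open>phi\<close> and \<open>cophi\<close> hold the two families
  of unary operations; in an $n$-valued algebra only the indices \<open>1, \<dots>, n - 1\<close> are meaningful.
\<close>

record 'a lm_struct = "'a gorder" +
  phi :: "nat \<Rightarrow> 'a \<Rightarrow> 'a"
  cophi :: "nat \<Rightarrow> 'a \<Rightarrow> 'a"

definition bounded_lattice_endo :: "('a, 'm) gorder_scheme \<Rightarrow> ('a \<Rightarrow> 'a) \<Rightarrow> bool" where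
  "bounded_lattice_endo L f \<longleftrightarrow>
     f \<in> carrier L \<rightarrow> carrier L \<and> join_pres L L f \<and> meet_pres L L f \<and>
     f \<bottom>\<^bsub>L\<^esub> = \<bottom>\<^bsub>L\<^esub> \<and> f \<top>\<^bsub>L\<^esub> = \<top>\<^bsub>L\<^esub>"

locale lm_algebra = bounded_lattice A for A :: "('a, 'm) lm_struct_scheme" (structure) +
  fixes n :: nat
  assumes distrib: "\<lbrakk>x \<in> carrier A; y \<in> carrier A; z \<in> carrier A\<rbrakk>
      \<Longrightarrow> x \<sqinter> (y \<squnion> z) = (x \<sqinter> y) \<squnion> (x \<sqinter> z)"
    and phi_endo: "i \<in> {1..n - 1} \<Longrightarrow> bounded_lattice_endo A (phi A i)"
    and cophi_closed: "i \<in> {1..n - 1} \<Longrightarrow> cophi A i \<in> carrier A \<rightarrow> carrier A"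
    and phi_join_cophi: "\<lbrakk>i \<in> {1..n - 1}; x \<in> carrier A\<rbrakk> \<Longrightarrow> phi A i x \<squnion> cophi A i x = \<top>"
    and phi_meet_cophi: "\<lbrakk>i \<in> {1..n - 1}; x \<in> carrier A\<rbrakk> \<Longrightarrow> phi A i x \<sqinter> cophi A i x = \<bottom>"
    and phi_phi: "\<lbrakk>i \<in> {1..n - 1}; j \<in> {1..n - 1}; x \<in> carrier A\<rbrakk>
      \<Longrightarrow> phi A i (phi A j x) = phi A j x"
    and phi_mono: "\<lbrakk>i \<in> {1..n - 1}; j \<in> {1..n - 1}; i \<le> j; x \<in> carrier A\<rbrakk>
      \<Longrightarrow> phi A i x \<sqsubseteq> phi A j x"
    and determination: "\<lbrakk>x \<in> carrier A; y \<in> carrier A; \<forall>i\<in>{1..n - 1}. phi A i x = phi A i y\<rbrakk>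
      \<Longrightarrow> x = y"

definition prime_filter :: "('a, 'm) gorder_scheme \<Rightarrow> 'a set \<Rightarrow> bool" where
  "prime_filter L P \<longleftrightarrow>
     P \<subseteq> carrier L \<and> P \<noteq> {} \<and> P \<noteq> carrier L \<and>
     (\<forall>x\<in>P. \<forall>y\<in>P. x \<sqinter>\<^bsub>L\<^esub> y \<in> P) \<and>
     (\<forall>x\<in>P. \<forall>y\<in>carrier L. x \<sqsubseteq>\<^bsub>L\<^esub> y \<longrightarrow> y \<in> P) \<and>
     (\<forall>x\<in>carrier L. \<forall>y\<in>carrier L. x \<squnion>\<^bsub>L\<^esub> y \<in> P \<longrightarrow> x \<in> P \<or> y \<in> P)"

definition prime_filters :: "('a, 'm) gorder_scheme \<Rightarrow> 'a set set" where
  "prime_filters L = {P. prime_filter L P}"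

definition sigma :: "('a, 'm) gorder_scheme \<Rightarrow> 'a \<Rightarrow> 'a set set" where
  "sigma L a = {P \<in> prime_filters L. a \<in> P}"

text \<open>
  The space underlying \<open>topology_generated_by\<close> is the union of the subbasis. Here this is the set of
  all prime filters, as soon as the carrier is nonempty.
\<close>

definition prime_filter_topology :: "('a, 'm) gorder_scheme \<Rightarrow> 'a set topology" where
  "prime_filter_topology L =
     topology_generated_by
       (sigma L ` carrier L \<union> (\<lambda>a. prime_filters L - sigma L a) ` carrier L)"

definition spec_map :: "('a, 'm) lm_struct_scheme \<Rightarrow> nat \<Rightarrow> 'a set \<Rightarrow> 'a set" where
  "spec_map A i P = phi A i -` P \<inter> carrier A"

definition modal :: "nat \<Rightarrow> ('a, 'm) lm_struct_scheme \<Rightarrow> 'a set set \<Rightarrow> bool" where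
  "modal n A Y \<longleftrightarrow>
     Y \<subseteq> prime_filters A \<and> (\<forall>i\<in>{1..n - 1}. Y = spec_map A i -` Y \<inter> prime_filters A)"

definition congruence :: "nat \<Rightarrow> ('a, 'm) lm_struct_scheme \<Rightarrow> 'a rel \<Rightarrow> bool" where
  "congruence n A \<theta> \<longleftrightarrow>
     equiv (carrier A) \<theta> \<and>
     (\<forall>(x, x') \<in> \<theta>. \<forall>(y, y') \<in> \<theta>.
        (x \<squnion>\<^bsub>A\<^esub> y, x' \<squnion>\<^bsub>A\<^esub> y') \<in> \<theta> \<and> (x \<sqinter>\<^bsub>A\<^esub> y, x' \<sqinter>\<^bsub>A\<^esub> y') \<in> \<theta>) \<and>
     (\<forall>i\<in>{1..n - 1}. \<forall>(x, x') \<in> \<theta>.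
        (phi A i x, phi A i x') \<in> \<theta> \<and> (cophi A i x, cophi A i x') \<in> \<theta>)"

definition inclusion_order :: "'b set set \<Rightarrow> 'b set gorder" where
  "inclusion_order \<F> = \<lparr>carrier = \<F>, eq = (=), le = (\<subseteq>)\<rparr>"

definition Con :: "nat \<Rightarrow> ('a, 'm) lm_struct_scheme \<Rightarrow> 'a rel gorder" where
  "Con n A = inclusion_order {\<theta>. congruence n A \<theta>}"

definition closed_modal :: "nat \<Rightarrow> ('a, 'm) lm_struct_scheme \<Rightarrow> 'a set set gorder" where
  "closed_modal n A = inclusion_order {Y. closedin (prime_filter_topology A) Y \<and> modal n A Y}"

definition open_modal :: "nat \<Rightarrow> ('a, 'm) lm_struct_scheme \<Rightarrow> 'a set set gorder" where
  "open_modal n A = inclusion_order {G. openin (prime_filter_topology A) G \<and> modal n A G}"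

definition Theta_M :: "('a, 'm) gorder_scheme \<Rightarrow> 'a set set \<Rightarrow> 'a rel" where
  "Theta_M L Y = {(a, b) \<in> carrier L \<times> carrier L. sigma L a \<inter> Y = sigma L b \<inter> Y}"

definition Theta_OM :: "('a, 'm) gorder_scheme \<Rightarrow> 'a set set \<Rightarrow> 'a rel" where
  "Theta_OM L G = {(a, b) \<in> carrier L \<times> carrier L. sym_diff (sigma L b) (sigma L a) \<subseteq> G}"

text \<open>
  The dual of a lattice is \<open>inv_gorder\<close>; \<open>join_pres\<close> and \<open>meet_pres\<close> include the assertion that both structures are lattices.
\<close>

definition lattice_iso ::
  "('a, 'm) gorder_scheme \<Rightarrow> ('b, 'k) gorder_scheme \<Rightarrow> ('a \<Rightarrow> 'b) \<Rightarrow> bool" where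
  "lattice_iso L M f \<longleftrightarrow>
     bij_betw f (carrier L) (carrier M) \<and> join_pres L M f \<and> meet_pres L M f"

end

theory Submission
  imports Defs
begin

text \<open>
  Closed sets of prime filters are separated from points by sets \<open>sigma A a - sigma A b\<close>, so
  \<open>Theta_M\<close> reverses inclusion in both directions on closed sets. A congruence \<open>\<theta>\<close> is recovered
  from the closed set of all prime filters saturated for it. The determination principle enters
  through the fact that every prime filter is fixed by some \<open>spec_map A i\<close>: it makes the set of
  saturated prime filters modal, and it shows that a prime filter containing \<open>{e. (e, \<top>) \<in> \<theta>}\<close> is
  already saturated, so that the usual prime filter theorem provides enough saturated prime filters.
  The open case follows by complementation.
\<close>

section \<open>Families of sets under inclusion, and lattice isomorphisms\<close>

lemma inclusion_order_simps [simp]: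
  "carrier (inclusion_order \<F>) = \<F>"
  "le (inclusion_order \<F>) = (\<subseteq>)"
  "eq (inclusion_order \<F>) = (=)"
  by (simp_all add: inclusion_order_def)

lemma partial_order_inclusion_order: "partial_order (inclusion_order \<F>)"
  by unfold_locales auto

lemma lattice_inclusion_order:
  assumes "\<And>X Y. X \<in> \<F> \<Longrightarrow> Y \<in> \<F> \<Longrightarrow> X \<union> Y \<in> \<F> \<and> X \<inter> Y \<in> \<F>"
  shows "lattice (inclusion_order \<F>)"
proof -
  interpret partial_order "inclusion_order \<F>"
    by (rule partial_order_inclusion_order)
  show ?thesis
  proof unfold_locales
    fix X Y assume "X \<in> carrier (inclusion_order \<F>)" "Y \<in> carrier (inclusion_order \<F>)"
    then have "X \<in> \<F>" "Y \<in> \<F>" by auto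
    then have "least (inclusion_order \<F>) (X \<union> Y) (Upper (inclusion_order \<F>) {X, Y})"
      "greatest (inclusion_order \<F>) (X \<inter> Y) (Lower (inclusion_order \<F>) {X, Y})"
      using assms by (auto simp: least_def greatest_def Upper_def Lower_def)
    then show "\<exists>s. least (inclusion_order \<F>) s (Upper (inclusion_order \<F>) {X, Y})"
      "\<exists>s. greatest (inclusion_order \<F>) s (Lower (inclusion_order \<F>) {X, Y})"
      by blast+
  qed
qed

text \<open>An order isomorphism transports suprema and infima, so the lattice structure of
  \<open>M\<close> comes out as part of the conclusion. With \<open>Con n A\<close> or its dual as
  \<open>M\<close>, no construction of joins of congruences is needed.\<close>

lemma lattice_isoI:
  assumes "lattice L" "partial_order M"
    and bij: "bij_betw f (carrier L) (carrier M)"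
    and ord: "\<And>x y. x \<in> carrier L \<Longrightarrow> y \<in> carrier L \<Longrightarrow> x \<sqsubseteq>\<^bsub>L\<^esub> y \<longleftrightarrow> f x \<sqsubseteq>\<^bsub>M\<^esub> f y"
  shows "lattice_iso L M f"
proof -
  interpret L: lattice L by fact
  interpret M: partial_order M by fact
  have f: "f x \<in> carrier M" if "x \<in> carrier L" for x
    using bij that by (rule bij_betwE[rule_format])
  have surj: "\<exists>x\<in>carrier L. z = f x" if "z \<in> carrier M" for z
    using bij that unfolding bij_betw_def by auto
  have lub: "least M (f (x \<squnion>\<^bsub>L\<^esub> y)) (Upper M {f x, f y})"
    if x: "x \<in> carrier L" and y: "y \<in> carrier L" for x y
  proof (rule least_UpperI)
    fix z assume "z \<in> {f x, f y}"
    then show "z \<sqsubseteq>\<^bsub>M\<^esub> f (x \<squnion>\<^bsub>L\<^esub> y)"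
      using x y by (auto simp: ord[symmetric] L.join_left L.join_right)
  next
    fix z assume z: "z \<in> Upper M {f x, f y}"
    then obtain w where "w \<in> carrier L" "z = f w"
      using surj[of z] by (auto simp: Upper_def)
    then show "f (x \<squnion>\<^bsub>L\<^esub> y) \<sqsubseteq>\<^bsub>M\<^esub> z"
      using x y z f by (auto simp: Upper_def ord[symmetric] intro!: L.join_le)
  qed (use f x y in auto)
  have glb: "greatest M (f (x \<sqinter>\<^bsub>L\<^esub> y)) (Lower M {f x, f y})"
    if x: "x \<in> carrier L" and y: "y \<in> carrier L" for x y
  proof (rule greatest_LowerI)
    fix z assume "z \<in> {f x, f y}"
    then show "f (x \<sqinter>\<^bsub>L\<^esub> y) \<sqsubseteq>\<^bsub>M\<^esub> z"
      using x y by (auto simp: ord[symmetric] L.meet_left L.meet_right)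
  next
    fix z assume z: "z \<in> Lower M {f x, f y}"
    then obtain w where "w \<in> carrier L" "z = f w"
      using surj[of z] by (auto simp: Lower_def)
    then show "z \<sqsubseteq>\<^bsub>M\<^esub> f (x \<sqinter>\<^bsub>L\<^esub> y)"
      using x y z f by (auto simp: Lower_def ord[symmetric] intro!: L.meet_le)
  qed (use f x y in auto)
  interpret M: lattice M
  proof unfold_locales
    fix u v assume "u \<in> carrier M" "v \<in> carrier M"
    then obtain x y where "x \<in> carrier L" "y \<in> carrier L" "u = f x" "v = f y"
      using surj by meson
    then show "\<exists>s. least M s (Upper M {u, v})" "\<exists>s. greatest M s (Lower M {u, v})"
      using lub glb by blast+
  qed
  have "f (x \<squnion>\<^bsub>L\<^esub> y) = f x \<squnion>\<^bsub>M\<^esub> f y" "f (x \<sqinter>\<^bsub>L\<^esub> y) = f x \<sqinter>\<^bsub>M\<^esub> f y"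
    if x: "x \<in> carrier L" and y: "y \<in> carrier L" for x y
    using M.weak_least_unique[OF lub[OF x y] M.sup_of_two_least]
      M.weak_greatest_unique[OF glb[OF x y] M.inf_of_two_greatest] f x y
    by (auto simp: join_def meet_def M.eq_is_equal)
  then show ?thesis
    using bij L.lattice_axioms M.lattice_axioms
    by (simp add: lattice_iso_def join_pres_def meet_pres_def)
qed

section \<open>Filters and the prime filter theorem for distributive lattices\<close>

definition lattice_filter :: "('a, 'm) gorder_scheme \<Rightarrow> 'a set \<Rightarrow> bool" where
  "lattice_filter L F \<longleftrightarrow>
     F \<subseteq> carrier L \<and> F \<noteq> {} \<and> (\<forall>x\<in>F. \<forall>y\<in>F. x \<sqinter>\<^bsub>L\<^esub> y \<in> F) \<and>
     (\<forall>x\<in>F. \<forall>y\<in>carrier L. x \<sqsubseteq>\<^bsub>L\<^esub> y \<longrightarrow> y \<in> F)"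

lemma lattice_filterI:
  assumes "F \<subseteq> carrier L" "a \<in> F" "\<And>x y. x \<in> F \<Longrightarrow> y \<in> F \<Longrightarrow> x \<sqinter>\<^bsub>L\<^esub> y \<in> F"
    "\<And>x y. x \<in> F \<Longrightarrow> y \<in> carrier L \<Longrightarrow> x \<sqsubseteq>\<^bsub>L\<^esub> y \<Longrightarrow> y \<in> F"
  shows "lattice_filter L F"
  using assms unfolding lattice_filter_def by blast

lemma lattice_filterD:
  assumes "lattice_filter L F"
  shows "x \<in> F \<Longrightarrow> x \<in> carrier L" "F \<noteq> {}" "x \<in> F \<Longrightarrow> y \<in> F \<Longrightarrow> x \<sqinter>\<^bsub>L\<^esub> y \<in> F"
    "x \<in> F \<Longrightarrow> y \<in> carrier L \<Longrightarrow> x \<sqsubseteq>\<^bsub>L\<^esub> y \<Longrightarrow> y \<in> F"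
  using assms unfolding lattice_filter_def by blast+

lemma prime_filter_iff:
  "prime_filter L P \<longleftrightarrow> lattice_filter L P \<and> P \<noteq> carrier L \<and>
     (\<forall>x\<in>carrier L. \<forall>y\<in>carrier L. x \<squnion>\<^bsub>L\<^esub> y \<in> P \<longrightarrow> x \<in> P \<or> y \<in> P)"
  unfolding prime_filter_def lattice_filter_def by blast

lemma lattice_filter_Union_chain:
  assumes "\<C> \<noteq> {}" "subset.chain \<A> \<C>" "\<And>G. G \<in> \<C> \<Longrightarrow> lattice_filter L G"
  shows "lattice_filter L (\<Union>\<C>)"
proof -
  have "x \<sqinter>\<^bsub>L\<^esub> y \<in> \<Union>\<C>" if xy: "x \<in> \<Union>\<C>" "y \<in> \<Union>\<C>" for x y
  proof -
    obtain G H where GH: "G \<in> \<C>" "x \<in> G" "H \<in> \<C>" "y \<in> H" using xy by blast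
    then have "G \<subseteq> H \<or> H \<subseteq> G" using assms(2) by (simp add: subset_chain_def)
    with GH obtain G where "G \<in> \<C>" "x \<in> G" "y \<in> G" by blast
    then show ?thesis using lattice_filterD(3)[OF assms(3)] by blast
  qed
  moreover have "y \<in> \<Union>\<C>" if xy: "x \<in> \<Union>\<C>" "y \<in> carrier L" "x \<sqsubseteq>\<^bsub>L\<^esub> y" for x y
  proof -
    obtain G where "G \<in> \<C>" "x \<in> G" using xy by blast
    then show ?thesis using lattice_filterD(4)[OF assms(3)] xy by blast
  qed
  moreover have "\<Union>\<C> \<subseteq> carrier L"
    using lattice_filterD(1)[OF assms(3)] by blast
  moreover obtain a where "a \<in> \<Union>\<C>"
    using assms(1) lattice_filterD(2)[OF assms(3)] by blast
  ultimately show ?thesis by (intro lattice_filterI)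
qed

text \<open>For a filter \<open>F\<close> and \<open>a\<close> in the carrier, this is the filter
  generated by \<open>F\<close> and \<open>a\<close>. One element of \<open>F\<close> suffices as a
  bound because \<open>F\<close> is closed under meets. The result may be improper.\<close>

definition adjoin :: "('a, 'm) gorder_scheme \<Rightarrow> 'a set \<Rightarrow> 'a \<Rightarrow> 'a set" where
  "adjoin L F a = {x \<in> carrier L. \<exists>e\<in>F. e \<sqinter>\<^bsub>L\<^esub> a \<sqsubseteq>\<^bsub>L\<^esub> x}"

context lattice
begin

lemma adjoin:
  assumes F: "lattice_filter L F" and a: "a \<in> carrier L"
  shows "lattice_filter L (adjoin L F a)" "F \<subseteq> adjoin L F a" "a \<in> adjoin L F a"
proof -
  have sub: "x \<in> carrier L" if "x \<in> F" for x
    using F that by (rule lattice_filterD)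
  show F': "F \<subseteq> adjoin L F a"
    unfolding adjoin_def by (intro subsetI CollectI conjI bexI[of _ _ F]) (simp_all add: sub a meet_left)
  obtain e where "e \<in> F" using lattice_filterD(2)[OF F] by blast
  then show "a \<in> adjoin L F a"
    unfolding adjoin_def by (intro CollectI conjI bexI[of _ e]) (simp_all add: sub a meet_right)
  have "x \<sqinter> y \<in> adjoin L F a" if m: "x \<in> adjoin L F a" "y \<in> adjoin L F a" for x y
  proof -
    obtain e e' where e: "e \<in> F" "e \<sqinter> a \<sqsubseteq> x" "e' \<in> F" "e' \<sqinter> a \<sqsubseteq> y"
      and xy: "x \<in> carrier L" "y \<in> carrier L"
      using m by (auto simp: adjoin_def)
    have c: "e \<in> carrier L" "e' \<in> carrier L" using e sub by auto
    have "(e \<sqinter> e') \<sqinter> a \<sqsubseteq> e \<sqinter> a" "(e \<sqinter> e') \<sqinter> a \<sqsubseteq> e' \<sqinter> a"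
      using c a by (meson meet_closed meet_le meet_left meet_right le_trans)+
    then have "(e \<sqinter> e') \<sqinter> a \<sqsubseteq> x" "(e \<sqinter> e') \<sqinter> a \<sqsubseteq> y"
      using e c a xy by (meson meet_closed le_trans)+
    then have "(e \<sqinter> e') \<sqinter> a \<sqsubseteq> x \<sqinter> y"
      using c a xy by (simp add: meet_le)
    then show ?thesis
      using lattice_filterD(3)[OF F e(1,3)] xy by (auto simp: adjoin_def)
  qed
  moreover have "y \<in> adjoin L F a" if x: "x \<in> adjoin L F a" and y: "y \<in> carrier L" "x \<sqsubseteq> y" for x y
  proof -
    obtain e where e: "e \<in> F" "e \<sqinter> a \<sqsubseteq> x" and xc: "x \<in> carrier L"
      using x by (auto simp: adjoin_def)
    have "e \<sqinter> a \<sqsubseteq> y"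
      by (rule le_trans[OF e(2) y(2)]) (simp_all add: sub e a xc y)
    then show ?thesis using e y by (auto simp: adjoin_def)
  qed
  moreover have "adjoin L F a \<subseteq> carrier L" by (auto simp: adjoin_def)
  ultimately show "lattice_filter L (adjoin L F a)"
    using \<open>a \<in> adjoin L F a\<close> by (intro lattice_filterI)
qed

text \<open>Zorn's lemma gives a filter \<open>M\<close> that is maximal among those containing
  \<open>F\<close> and omitting \<open>b\<close>. Distributivity then makes \<open>M\<close>
  prime.\<close>

lemma prime_filter_separation:
  assumes distrib: "\<And>x y z. \<lbrakk>x \<in> carrier L; y \<in> carrier L; z \<in> carrier L\<rbrakk>
      \<Longrightarrow> x \<sqinter> (y \<squnion> z) = (x \<sqinter> y) \<squnion> (x \<sqinter> z)"
    and F: "lattice_filter L F" and b: "b \<in> carrier L" "b \<notin> F"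
  obtains P where "prime_filter L P" "F \<subseteq> P" "b \<notin> P"
proof -
  define \<A> where "\<A> = {G. lattice_filter L G \<and> F \<subseteq> G \<and> b \<notin> G}"
  have "F \<in> \<A>" using F b by (simp add: \<A>_def)
  moreover have "\<Union>\<C> \<in> \<A>" if "\<C> \<noteq> {}" and ch: "subset.chain \<A> \<C>" for \<C>
  proof -
    have sub: "\<C> \<subseteq> \<A>" using ch by (simp add: subset_chain_def)
    then have "lattice_filter L (\<Union>\<C>)"
      using \<open>\<C> \<noteq> {}\<close> ch by (intro lattice_filter_Union_chain) (auto simp: \<A>_def)
    then show ?thesis
      using sub \<open>\<C> \<noteq> {}\<close> by (auto simp: \<A>_def)
  qed
  ultimately obtain M where M: "M \<in> \<A>" and max: "\<And>G. G \<in> \<A> \<Longrightarrow> M \<subseteq> G \<Longrightarrow> G = M"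
    using subset_Zorn_nonempty[of \<A>] by blast
  have MF: "lattice_filter L M" and bM: "b \<notin> M" using M by (auto simp: \<A>_def)
  have sub: "x \<in> carrier L" if "x \<in> M" for x
    using MF that by (rule lattice_filterD)
  \<comment> \<open>By maximality the filter generated by \<open>M\<close> and \<open>x\<close>
    cannot omit \<open>b\<close>.\<close>
  have below: "\<exists>e\<in>M. e \<sqinter> x \<sqsubseteq> b" if "x \<in> carrier L" "x \<notin> M" for x
  proof (rule ccontr)
    assume "\<not> ?thesis"
    then have "b \<notin> adjoin L M x" by (simp add: adjoin_def)
    then have "adjoin L M x \<in> \<A>"
      using adjoin(1,2)[OF MF that(1)] M unfolding \<A>_def by blast
    then have "adjoin L M x = M" using adjoin(2)[OF MF that(1)] by (rule max)
    then show False using adjoin(3)[OF MF that(1)] that(2) by simp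
  qed
  have "x \<in> M \<or> y \<in> M" if x: "x \<in> carrier L" and y: "y \<in> carrier L" and "x \<squnion> y \<in> M" for x y
  proof (rule ccontr)
    assume "\<not> ?thesis"
    then have "x \<notin> M" "y \<notin> M" by simp_all
    then obtain e e' where e: "e \<in> M" "e' \<in> M" "e \<sqinter> x \<sqsubseteq> b" "e' \<sqinter> y \<sqsubseteq> b"
      using below[OF x] below[OF y] by metis
    have c: "e \<in> carrier L" "e' \<in> carrier L" using e sub by auto
    \<comment> \<open>The common element \<open>e \<sqinter> e'\<close> serves both estimates, so
      distributivity bounds its meet with \<open>x \<squnion> y\<close> by \<open>b\<close>. That
      meet lies in \<open>M\<close>, which would force \<open>b\<close> into
      \<open>M\<close>.\<close>
    have "(e \<sqinter> e') \<sqinter> x \<sqsubseteq> e \<sqinter> x" "(e \<sqinter> e') \<sqinter> y \<sqsubseteq> e' \<sqinter> y"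
      using c x y by (meson meet_closed meet_le meet_left meet_right le_trans)+
    then have "(e \<sqinter> e') \<sqinter> x \<sqsubseteq> b" "(e \<sqinter> e') \<sqinter> y \<sqsubseteq> b"
      using e c x y b by (meson meet_closed le_trans)+
    then have "(e \<sqinter> e') \<sqinter> (x \<squnion> y) \<sqsubseteq> b"
      using c x y b by (simp add: distrib join_le)
    moreover have "(e \<sqinter> e') \<sqinter> (x \<squnion> y) \<in> M"
      using MF e \<open>x \<squnion> y \<in> M\<close> by (intro lattice_filterD(3))
    ultimately show False using lattice_filterD(4)[OF MF] b(1) bM by blast
  qed
  then have "prime_filter L M"
    using MF b bM unfolding prime_filter_iff by (intro conjI ballI impI) auto
  then show thesis using that M by (auto simp: \<A>_def)
qed

end

section \<open>Prime filters of a bounded lattice and the topology on them\<close>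

context bounded_lattice
begin

text \<open>Membership in a prime filter is a homomorphism onto the two-element lattice. Used as
  rewrite rules, these facts turn lattice statements into propositional ones.\<close>

lemma prime_filter_mem:
  assumes "prime_filter L P"
  shows "\<top> \<in> P" "\<bottom> \<notin> P"
    and "x \<in> carrier L \<Longrightarrow> y \<in> carrier L \<Longrightarrow> x \<sqinter> y \<in> P \<longleftrightarrow> x \<in> P \<and> y \<in> P"
    and "x \<in> carrier L \<Longrightarrow> y \<in> carrier L \<Longrightarrow> x \<squnion> y \<in> P \<longleftrightarrow> x \<in> P \<or> y \<in> P"
proof -
  have F: "lattice_filter L P" and ne: "P \<noteq> carrier L"
    and prime: "x \<in> carrier L \<Longrightarrow> y \<in> carrier L \<Longrightarrow> x \<squnion> y \<in> P \<Longrightarrow> x \<in> P \<or> y \<in> P" for x y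
    using assms unfolding prime_filter_iff by simp_all
  note sub = lattice_filterD(1)[OF F] and up = lattice_filterD(4)[OF F]
  obtain p where p: "p \<in> P" using lattice_filterD(2)[OF F] by blast
  then show "\<top> \<in> P" by (rule up) (simp_all add: sub[OF p])
  show "\<bottom> \<notin> P"
  proof
    assume "\<bottom> \<in> P"
    then have "x \<in> P" if "x \<in> carrier L" for x
      using that by (rule up) (simp add: that)
    then have "carrier L \<subseteq> P" by (rule subsetI)
    moreover have "P \<subseteq> carrier L" using sub by (rule subsetI)
    ultimately show False using ne by simp
  qed
  show "x \<sqinter> y \<in> P \<longleftrightarrow> x \<in> P \<and> y \<in> P" if "x \<in> carrier L" "y \<in> carrier L"
    using up[OF _ that(1) meet_left[OF that]] up[OF _ that(2) meet_right[OF that]]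
      lattice_filterD(3)[OF F] by metis
  show "x \<squnion> y \<in> P \<longleftrightarrow> x \<in> P \<or> y \<in> P" if "x \<in> carrier L" "y \<in> carrier L"
    using up[OF _ join_closed[OF that] join_left[OF that]]
      up[OF _ join_closed[OF that] join_right[OF that]] prime[OF that] by metis
qed

lemma openin_sigma:
  assumes "a \<in> carrier L"
  shows "openin (prime_filter_topology L) (sigma L a)"
    "openin (prime_filter_topology L) (prime_filters L - sigma L a)"
  using assms by (auto simp: prime_filter_topology_def intro: topology_generated_by_Basis)

lemma topspace_prime_filter_topology: "topspace (prime_filter_topology L) = prime_filters L"
  using top_closed by (auto simp: prime_filter_topology_def sigma_def)

text \<open>The differences \<open>sigma L a - sigma L b\<close> include the subbasis and are closed
  under binary intersection, so they form a basis. The proof follows the generation of open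
  sets.\<close>

lemma prime_filter_topology_basis:
  assumes "openin (prime_filter_topology L) U" "P \<in> U"
  obtains a b where "a \<in> carrier L" "b \<in> carrier L" "P \<in> sigma L a - sigma L b"
    "sigma L a - sigma L b \<subseteq> U"
proof -
  have "generate_topology_on
      (sigma L ` carrier L \<union> (\<lambda>a. prime_filters L - sigma L a) ` carrier L) U"
    using assms(1) by (simp add: prime_filter_topology_def openin_topology_generated_by_iff)
  then have "\<exists>a\<in>carrier L. \<exists>b\<in>carrier L. P \<in> sigma L a - sigma L b \<and> sigma L a - sigma L b \<subseteq> U"
    using assms(2)
  proof induction
    case (Int U V)
    then obtain a b c d where
      abcd: "a \<in> carrier L" "b \<in> carrier L" "c \<in> carrier L" "d \<in> carrier L"
      and "P \<in> sigma L a - sigma L b" "sigma L a - sigma L b \<subseteq> U"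
        "P \<in> sigma L c - sigma L d" "sigma L c - sigma L d \<subseteq> V"
      by auto
    moreover have "sigma L (a \<sqinter> c) - sigma L (b \<squnion> d)
        = (sigma L a - sigma L b) \<inter> (sigma L c - sigma L d)"
      using abcd by (auto simp: sigma_def prime_filters_def prime_filter_mem)
    ultimately show ?case
      by (intro bexI[of _ "a \<sqinter> c"] bexI[of _ "b \<squnion> d"]) auto
  next
    case (UN K)
    then obtain k where "k \<in> K" "P \<in> k" by blast
    from UN.IH[OF this] show ?case
      using Sup_upper[OF \<open>k \<in> K\<close>] by (meson order_trans)
  next
    case (Basis s)
    \<comment> \<open>The bounds of the lattice write both kinds of subbasic set as such a
      difference.\<close>
    have "sigma L \<bottom> = {}" "sigma L \<top> = prime_filters L"
      by (auto simp: sigma_def prime_filters_def prime_filter_mem)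
    then have "s = sigma L a \<Longrightarrow> s = sigma L a - sigma L \<bottom>"
      "s = prime_filters L - sigma L a \<Longrightarrow> s = sigma L \<top> - sigma L a" for a
      by auto
    then obtain a b where "a \<in> carrier L" "b \<in> carrier L" "s = sigma L a - sigma L b"
      using Basis(1) bottom_closed top_closed by (elim UnE imageE) metis+
    then show ?case
      using Basis(2) by (intro bexI[of _ a] bexI[of _ b]) simp_all
  qed simp
  then show thesis by (elim bexE conjE) (rule that)
qed

end

section \<open>The operations \<open>phi\<close> and \<open>cophi\<close> and the maps
  \<open>spec_map\<close> on prime filters\<close>

context lm_algebra
begin

lemma phi_closed [simp]: "i \<in> {1..n - 1} \<Longrightarrow> x \<in> carrier A \<Longrightarrow> phi A i x \<in> carrier A"
  using phi_endo by (auto simp: bounded_lattice_endo_def)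

lemma cophi_closed' [simp]: "i \<in> {1..n - 1} \<Longrightarrow> x \<in> carrier A \<Longrightarrow> cophi A i x \<in> carrier A"
  using cophi_closed by auto

lemma phi_hom:
  assumes "i \<in> {1..n - 1}"
  shows "phi A i \<bottom> = \<bottom>" "phi A i \<top> = \<top>"
    and "x \<in> carrier A \<Longrightarrow> y \<in> carrier A \<Longrightarrow> phi A i (x \<sqinter> y) = phi A i x \<sqinter> phi A i y"
    and "x \<in> carrier A \<Longrightarrow> y \<in> carrier A \<Longrightarrow> phi A i (x \<squnion> y) = phi A i x \<squnion> phi A i y"
  using phi_endo[OF assms] by (auto simp: bounded_lattice_endo_def join_pres_def meet_pres_def)

lemma phi_isotone:
  assumes "i \<in> {1..n - 1}" "x \<in> carrier A" "y \<in> carrier A" "x \<sqsubseteq> y"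
  shows "phi A i x \<sqsubseteq> phi A i y"
  using assms phi_hom(3)[OF assms(1-3)] by (metis le_iff_join phi_closed)

lemma mem_spec_map: "x \<in> spec_map A i P \<longleftrightarrow> x \<in> carrier A \<and> phi A i x \<in> P"
  by (auto simp: spec_map_def)

text \<open>A prime filter contains \<open>\<top>\<close> and omits \<open>\<bottom>\<close>, so it
  contains exactly one of two complementary elements.\<close>

lemma cophi_mem:
  assumes "prime_filter A P" "i \<in> {1..n - 1}" "x \<in> carrier A"
  shows "cophi A i x \<in> P \<longleftrightarrow> phi A i x \<notin> P"
  using assms prime_filter_mem[OF assms(1)] phi_join_cophi[OF assms(2,3)]
    phi_meet_cophi[OF assms(2,3)] by (metis cophi_closed' phi_closed)

lemma prime_filter_spec_map:
  assumes P: "prime_filter A P" and i: "i \<in> {1..n - 1}"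
  shows "prime_filter A (spec_map A i P)"
proof -
  have "\<top> \<in> spec_map A i P" "\<bottom> \<notin> spec_map A i P"
    using prime_filter_mem[OF P] phi_hom[OF i] by (auto simp: mem_spec_map)
  moreover have "y \<in> spec_map A i P" if "x \<in> spec_map A i P" "y \<in> carrier A" "x \<sqsubseteq> y" for x y
    using that P i phi_isotone[OF i] unfolding mem_spec_map prime_filter_def by (metis phi_closed)
  moreover have "spec_map A i P \<subseteq> carrier A" by (auto simp: mem_spec_map)
  moreover have "x \<sqinter> y \<in> spec_map A i P" if "x \<in> spec_map A i P" "y \<in> spec_map A i P" for x y
    using that i prime_filter_mem[OF P] phi_hom[OF i] by (simp add: mem_spec_map)
  moreover have "x \<in> spec_map A i P \<or> y \<in> spec_map A i P"
    if "x \<in> carrier A" "y \<in> carrier A" "x \<squnion> y \<in> spec_map A i P" for x y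
    using that i prime_filter_mem[OF P] phi_hom[OF i] by (simp add: mem_spec_map)
  ultimately show ?thesis
    unfolding prime_filter_def using bottom_closed by blast
qed

text \<open>Taking preimages reverses composition: in \<open>phi_phi\<close> the inner operation
  survives, here the outer map does.\<close>

lemma spec_map_spec_map:
  assumes "i \<in> {1..n - 1}" "j \<in> {1..n - 1}"
  shows "spec_map A j (spec_map A i P) = spec_map A j P"
  using assms by (auto simp: mem_spec_map phi_phi)

text \<open>If \<open>u\<close> is not below \<open>v\<close>, the principal filter of
  \<open>u\<close> omits \<open>v\<close> and extends to a prime filter that still omits
  \<open>v\<close>.\<close>

lemma eq_if_prime_filters_eq:
  assumes "x \<in> carrier A" "y \<in> carrier A"
    and eq: "\<And>P. prime_filter A P \<Longrightarrow> x \<in> P \<longleftrightarrow> y \<in> P"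
  shows "x = y"
proof -
  have le: "u \<sqsubseteq> v" if u: "u \<in> carrier A" and v: "v \<in> carrier A"
    and imp: "\<And>P. prime_filter A P \<Longrightarrow> u \<in> P \<Longrightarrow> v \<in> P" for u v
  proof (rule ccontr)
    assume "\<not> u \<sqsubseteq> v"
    moreover have "lattice_filter A {z \<in> carrier A. u \<sqsubseteq> z}"
      using u unfolding lattice_filter_def by (auto intro: meet_le le_trans)
    ultimately obtain P where "prime_filter A P" "{z \<in> carrier A. u \<sqsubseteq> z} \<subseteq> P" "v \<notin> P"
      using prime_filter_separation[OF distrib, of _ v] v by blast
    then show False using imp u by auto
  qed
  show ?thesis using assms by (intro le_antisym le) simp_all
qed

text \<open>If \<open>P\<close> differed from all \<open>spec_map A i P\<close>, finitely many witnesses combine into \<open>a \<in> P\<close>,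
  \<open>b \<notin> P\<close> and some \<open>e \<in> P\<close> fixed by all \<open>phi A i\<close> with \<open>phi A i (a \<sqinter> e) \<sqsubseteq> phi A i b\<close>, and then
  determination gives \<open>a \<sqinter> e \<sqsubseteq> b\<close>.\<close>

lemma prime_filter_fixed:
  assumes P: "prime_filter A P"
  obtains i where "i \<in> {1..n - 1}" "spec_map A i P = P"
proof (rule ccontr)
  assume "\<not> thesis"
  with that have neq: "spec_map A i P \<noteq> P" if "i \<in> {1..n - 1}" for i using that by blast
  have sub: "x \<in> carrier A" if "x \<in> P" for x
    using P that by (auto simp: prime_filter_def)
  note mem = prime_filter_mem prime_filter_spec_map mem_spec_map cophi_mem
  \<comment> \<open>Identities and inequalities are phrased as membership in all prime filters
    \<open>Q\<close>. The first clause says that every \<open>phi A j\<close> fixes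
    \<open>e\<close>, the second that \<open>e \<sqinter> phi A i a \<sqsubseteq> phi A i b\<close>
    for all \<open>i \<in> I\<close>.\<close>
  have "\<exists>a\<in>P. \<exists>b\<in>carrier A - P. \<exists>e\<in>P.
      (\<forall>Q. prime_filter A Q \<longrightarrow> (\<forall>j\<in>{1..n - 1}. phi A j e \<in> Q \<longleftrightarrow> e \<in> Q)) \<and>
      (\<forall>Q. prime_filter A Q \<longrightarrow> (\<forall>i\<in>I. e \<in> Q \<longrightarrow> phi A i a \<in> Q \<longrightarrow> phi A i b \<in> Q))"
    if "finite I" "I \<subseteq> {1..n - 1}" for I
    using that
  proof (induction I)
    case empty
    have "\<top> \<in> P" "\<bottom> \<in> carrier A - P" using mem(1,2)[OF P] by auto
    then show ?case
      by (intro bexI[of _ "\<top>"] bexI[of _ "\<bottom>"]) (auto simp: phi_hom mem)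
  next
    case (insert k I)
    then have k: "k \<in> {1..n - 1}" by simp
    obtain a b e where a: "a \<in> P" and b: "b \<in> carrier A" "b \<notin> P" and e: "e \<in> P"
      and stable: "\<And>Q j. prime_filter A Q \<Longrightarrow> j \<in> {1..n - 1} \<Longrightarrow> phi A j e \<in> Q \<longleftrightarrow> e \<in> Q"
      and imp: "\<And>Q i. prime_filter A Q \<Longrightarrow> i \<in> I \<Longrightarrow> e \<in> Q \<Longrightarrow> phi A i a \<in> Q \<Longrightarrow> phi A i b \<in> Q"
      using insert by auto
    \<comment> \<open>Some \<open>x\<close> lies in exactly one of \<open>P\<close> and
      \<open>spec_map A k P\<close>. If \<open>x \<in> P\<close>, take \<open>a' = x\<close> and
      \<open>b' = \<bottom>\<close>; otherwise take \<open>a' = \<top>\<close> and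
      \<open>b' = x\<close>.\<close>
    obtain a' b' where a': "a' \<in> P" and b': "b' \<in> carrier A" "b' \<notin> P"
      and ab': "phi A k a' \<notin> P \<or> phi A k b' \<in> P"
    proof -
      consider x where "x \<in> P" "phi A k x \<notin> P"
        | x where "x \<in> carrier A" "x \<notin> P" "phi A k x \<in> P"
        using neq[OF k] sub by (fastforce simp: mem_spec_map)
      then show thesis
        using that mem(1,2)[OF P] by cases blast+
    qed
    \<comment> \<open>This is the implication from \<open>phi A k a'\<close> to
      \<open>phi A k b'\<close>, which exists because \<open>cophi A k a'\<close> is a complement of
      \<open>phi A k a'\<close>. The choice of \<open>a'\<close> and \<open>b'\<close> puts it into
      \<open>P\<close>.\<close>
    define e' where "e' = cophi A k a' \<squnion> phi A k b'"
    note c = a[THEN sub] a'[THEN sub] e[THEN sub] b(1) b'(1)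
    have c': "e' \<in> carrier A" using c k by (simp add: e'_def)
    have e': "e' \<in> Q \<longleftrightarrow> phi A k a' \<notin> Q \<or> phi A k b' \<in> Q" if "prime_filter A Q" for Q
      using that c k by (simp add: e'_def mem)
    \<comment> \<open>Membership of \<open>e'\<close> is decided by \<open>phi A k a'\<close> and
      \<open>phi A k b'\<close>, on which \<open>phi A j\<close> acts trivially. So
      \<open>e'\<close> lies in \<open>spec_map A j Q\<close> exactly when it lies in
      \<open>Q\<close>.\<close>
    have stable': "phi A j e' \<in> Q \<longleftrightarrow> e' \<in> Q" if Q: "prime_filter A Q" and j: "j \<in> {1..n - 1}" for Q j
      using e'[OF prime_filter_spec_map[OF Q j]] e'[OF Q] c c' j k by (simp add: mem_spec_map phi_phi)
    show ?case
    proof (rule bexI[of _ "a \<sqinter> a'"], rule bexI[of _ "b \<squnion> b'"], rule bexI[of _ "e \<sqinter> e'"],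
        intro conjI allI impI ballI)
      show "a \<sqinter> a' \<in> P" "e \<sqinter> e' \<in> P" "b \<squnion> b' \<in> carrier A - P"
        using a a' b b' e c c' ab' e'[OF P] P by (auto simp: mem)
      show "phi A j (e \<sqinter> e') \<in> Q \<longleftrightarrow> e \<sqinter> e' \<in> Q"
        if "prime_filter A Q" "j \<in> {1..n - 1}" for Q j
        using that c c' by (simp add: phi_hom mem stable stable')
      show "phi A i (b \<squnion> b') \<in> Q"
        if Q: "prime_filter A Q" and i: "i \<in> insert k I"
          and m: "e \<sqinter> e' \<in> Q" "phi A i (a \<sqinter> a') \<in> Q" for Q i
      proof -
        have i': "i \<in> {1..n - 1}" using i insert by auto
        have "e \<in> Q" "e' \<in> Q" "phi A i a \<in> Q" "phi A i a' \<in> Q"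
          using m Q c c' i' by (auto simp: phi_hom mem)
        then have "phi A i b \<in> Q \<or> phi A i b' \<in> Q"
          using i imp[OF Q] e'[OF Q] by auto
        then show ?thesis using Q c i' by (auto simp: phi_hom mem)
      qed
    qed
  qed
  from this[of "{1..n - 1}"] obtain a b e where a: "a \<in> P" and b: "b \<in> carrier A" "b \<notin> P" and e: "e \<in> P"
    and stable: "\<And>Q j. prime_filter A Q \<Longrightarrow> j \<in> {1..n - 1} \<Longrightarrow> phi A j e \<in> Q \<longleftrightarrow> e \<in> Q"
    and imp: "\<And>Q i. prime_filter A Q \<Longrightarrow> i \<in> {1..n - 1} \<Longrightarrow> e \<in> Q \<Longrightarrow> phi A i a \<in> Q \<Longrightarrow> phi A i b \<in> Q"
    by auto
  note c = a[THEN sub] e[THEN sub] b(1)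
  \<comment> \<open>A prime filter containing the left side contains \<open>phi A i a\<close> and,
    by stability, \<open>e\<close>; hence it contains \<open>phi A i b\<close> as well.\<close>
  have "phi A i (a \<sqinter> e) = phi A i (a \<sqinter> e \<sqinter> b)" if i: "i \<in> {1..n - 1}" for i
  proof (rule eq_if_prime_filters_eq)
    fix Q assume "prime_filter A Q"
    then show "phi A i (a \<sqinter> e) \<in> Q \<longleftrightarrow> phi A i (a \<sqinter> e \<sqinter> b) \<in> Q"
      using c i stable imp by (auto simp: phi_hom mem)
  qed (use c i in auto)
  then have "a \<sqinter> e = a \<sqinter> e \<sqinter> b"
    using c by (intro determination) auto
  moreover have "a \<sqinter> e \<in> P" "a \<sqinter> e \<sqinter> b \<notin> P"
    using P a b e c by (auto simp: mem)
  ultimately show False by simp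
qed

section \<open>Closed modal sets and congruences\<close>

lemma congruence_Theta_M:
  assumes "modal n A Y"
  shows "congruence n A (Theta_M A Y)"
proof -
  have Y: "prime_filter A P" if "P \<in> Y" for P
    using assms that by (auto simp: modal_def prime_filters_def)
  have fY: "spec_map A i P \<in> Y" if "P \<in> Y" "i \<in> {1..n - 1}" for P i
    using assms that unfolding modal_def by blast
  have Theta: "(a, b) \<in> Theta_M A Y \<longleftrightarrow>
      a \<in> carrier A \<and> b \<in> carrier A \<and> (\<forall>P\<in>Y. a \<in> P \<longleftrightarrow> b \<in> P)" for a b
    using Y by (auto simp: Theta_M_def sigma_def prime_filters_def)
  have "equiv (carrier A) (Theta_M A Y)"
    by (auto simp: equiv_def refl_on_def sym_def trans_def Theta_M_def)
  moreover have "(x \<squnion> y, x' \<squnion> y') \<in> Theta_M A Y" "(x \<sqinter> y, x' \<sqinter> y') \<in> Theta_M A Y"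
    if "(x, x') \<in> Theta_M A Y" "(y, y') \<in> Theta_M A Y" for x x' y y'
    using that by (simp_all add: Theta prime_filter_mem[OF Y])
  moreover have phi: "phi A i x \<in> P \<longleftrightarrow> phi A i y \<in> P"
    if "(x, y) \<in> Theta_M A Y" "i \<in> {1..n - 1}" "P \<in> Y" for x y i P
  proof -
    \<comment> \<open>Modality keeps \<open>spec_map A i P\<close> in \<open>Y\<close>, so the
      relation between \<open>x\<close> and \<open>y\<close> may be tested at that point instead of
      \<open>P\<close>.\<close>
    have "x \<in> spec_map A i P \<longleftrightarrow> y \<in> spec_map A i P"
      using that(1) fY[OF that(3,2)] by (simp add: Theta)
    then show ?thesis using that(1) by (simp add: Theta mem_spec_map)
  qed
  have "(phi A i x, phi A i y) \<in> Theta_M A Y" "(cophi A i x, cophi A i y) \<in> Theta_M A Y"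
    if "(x, y) \<in> Theta_M A Y" "i \<in> {1..n - 1}" for x y i
    using that phi[OF that] by (simp_all add: Theta cophi_mem[OF Y])
  ultimately show ?thesis
    unfolding congruence_def by (intro conjI ballI case_prodI2) simp_all
qed

text \<open>For a congruence \<theta> these are the inverse images of the prime filters of the
  quotient by \<theta>. They form the largest set of prime filters that identifies all
  \<theta>-related elements.\<close>

definition saturated_primes :: "'a rel \<Rightarrow> 'a set set" where
  "saturated_primes \<theta> = {P \<in> prime_filters A. \<forall>(a, b)\<in>\<theta>. a \<in> P \<longleftrightarrow> b \<in> P}"

lemma closedin_saturated_primes:
  assumes "\<theta> \<subseteq> carrier A \<times> carrier A"
  shows "closedin (prime_filter_topology A) (saturated_primes \<theta>)"
proof -
  have "prime_filters A - saturated_primes \<theta> =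
      (\<Union>(a, b)\<in>\<theta>. (sigma A a \<inter> (prime_filters A - sigma A b))
        \<union> (sigma A b \<inter> (prime_filters A - sigma A a)))"
    by (auto simp: saturated_primes_def sigma_def)
  also have "openin (prime_filter_topology A) \<dots>"
    using assms by (intro openin_Union) (auto intro!: openin_sigma)
  finally show ?thesis
    by (auto simp: closedin_def topspace_prime_filter_topology saturated_primes_def)
qed

text \<open>Stability under \<open>spec_map A i\<close> holds because \<theta> respects
  \<open>phi A i\<close>. Conversely, if \<open>spec_map A j\<close> fixes \<open>P\<close>, then
  \<open>P\<close> is also the image of \<open>spec_map A i P\<close> under
  \<open>spec_map A j\<close>, so saturation passes back from \<open>spec_map A i P\<close> to
  \<open>P\<close>.\<close>

lemma modal_saturated_primes:
  assumes \<theta>: "congruence n A \<theta>"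
  shows "modal n A (saturated_primes \<theta>)"
proof -
  have sub: "\<theta> \<subseteq> carrier A \<times> carrier A"
    using \<theta> by (auto simp: congruence_def equiv_def)
  have spec: "spec_map A i P \<in> saturated_primes \<theta>"
    if "P \<in> saturated_primes \<theta>" "i \<in> {1..n - 1}" for P i
  proof -
    have "phi A i a \<in> P \<longleftrightarrow> phi A i b \<in> P" if "(a, b) \<in> \<theta>" for a b
    proof -
      have "(phi A i a, phi A i b) \<in> \<theta>"
        using \<theta> \<open>i \<in> {1..n - 1}\<close> that unfolding congruence_def by blast
      then show ?thesis using \<open>P \<in> saturated_primes \<theta>\<close> by (auto simp: saturated_primes_def)
    qed
    then show ?thesis
      using that sub unfolding saturated_primes_def
      by (auto simp: prime_filters_def prime_filter_spec_map mem_spec_map)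
  qed
  have "P \<in> saturated_primes \<theta>"
    if "spec_map A i P \<in> saturated_primes \<theta>" "i \<in> {1..n - 1}" "P \<in> prime_filters A" for P i
    using that spec spec_map_spec_map prime_filter_fixed[of P]
    by (metis mem_Collect_eq prime_filters_def)
  moreover have "saturated_primes \<theta> \<subseteq> prime_filters A"
    by (auto simp: saturated_primes_def)
  ultimately show ?thesis
    using spec unfolding modal_def by blast
qed

lemma saturated_if_kernel_subset:
  assumes \<theta>: "congruence n A \<theta>" and P: "prime_filter A P" and ker: "{e. (e, \<top>) \<in> \<theta>} \<subseteq> P"
  shows "P \<in> saturated_primes \<theta>"
proof -
  have eqv: "equiv (carrier A) \<theta>" using \<theta> by (simp add: congruence_def)
  have imp: "b \<in> P" if ab: "(a, b) \<in> \<theta>" and a: "a \<in> P" for a b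
  proof -
    have c: "a \<in> carrier A" "b \<in> carrier A" using ab eqv by (auto simp: equiv_def)
    \<comment> \<open>With this index, an element of the carrier lies in \<open>P\<close> exactly
      when its image under \<open>phi A i\<close> does, and such images have complements.\<close>
    obtain i where i: "i \<in> {1..n - 1}" "spec_map A i P = P"
      using prime_filter_fixed[OF P] .
    have "(phi A i b, phi A i b) \<in> \<theta>" using eqv c i by (auto simp: equiv_def refl_on_def)
    moreover have "(cophi A i a, cophi A i b) \<in> \<theta>"
      using \<theta> ab i unfolding congruence_def by blast
    \<comment> \<open>The left entry is the implication from \<open>phi A i a\<close> to
      \<open>phi A i b\<close>. The right entry is \<open>\<top>\<close>, so the left one belongs to
      the kernel and hence to \<open>P\<close>.\<close>
    ultimately have "(phi A i b \<squnion> cophi A i a, phi A i b \<squnion> cophi A i b) \<in> \<theta>"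
      using \<theta> unfolding congruence_def by blast
    then have "phi A i b \<squnion> cophi A i a \<in> P"
      using ker c i by (auto simp: phi_join_cophi)
    then have "phi A i b \<in> P \<or> phi A i a \<notin> P"
      using P c i by (simp add: prime_filter_mem cophi_mem)
    then show ?thesis using i a c by (metis mem_spec_map)
  qed
  moreover have "(b, a) \<in> \<theta>" if "(a, b) \<in> \<theta>" for a b
    using that eqv by (auto simp: equiv_def sym_def)
  ultimately show ?thesis
    using P by (auto simp: saturated_primes_def prime_filters_def)
qed

lemma Theta_M_saturated_primes:
  assumes \<theta>: "congruence n A \<theta>"
  shows "Theta_M A (saturated_primes \<theta>) = \<theta>"
proof
  have eqv: "equiv (carrier A) \<theta>" using \<theta> by (simp add: congruence_def)
  then have sub: "\<theta> \<subseteq> carrier A \<times> carrier A" and refl: "\<And>x. x \<in> carrier A \<Longrightarrow> (x, x) \<in> \<theta>"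
    and sym: "\<And>x y. (x, y) \<in> \<theta> \<Longrightarrow> (y, x) \<in> \<theta>"
    and trans: "\<And>x y z. (x, y) \<in> \<theta> \<Longrightarrow> (y, z) \<in> \<theta> \<Longrightarrow> (x, z) \<in> \<theta>"
    by (auto simp: equiv_def refl_on_def dest: symD transD)
  have meet: "(x \<sqinter> y, x' \<sqinter> y') \<in> \<theta>" and join: "(x \<squnion> y, x' \<squnion> y') \<in> \<theta>"
    if "(x, x') \<in> \<theta>" "(y, y') \<in> \<theta>" for x x' y y'
    using \<theta> that unfolding congruence_def by blast+
  show "\<theta> \<subseteq> Theta_M A (saturated_primes \<theta>)"
    using sub by (auto simp: Theta_M_def saturated_primes_def sigma_def)
  define F where "F = {e. (e, \<top>) \<in> \<theta>}"
  have F: "lattice_filter A F"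
  proof -
    have "x \<sqinter> y \<in> F" if "x \<in> F" "y \<in> F" for x y
      using meet[of x \<top> y \<top>] that le_iff_join[of \<top> \<top>] by (simp add: F_def)
    moreover have "y \<in> F" if x: "x \<in> F" and y: "y \<in> carrier A" and "x \<sqsubseteq> y" for x y
    proof -
      have "(x \<squnion> y, \<top> \<squnion> y) \<in> \<theta>" using join refl x y by (simp add: F_def)
      moreover have "x \<squnion> y = y" "\<top> \<squnion> y = \<top>"
        using that sub top_join[OF y] by (auto simp: F_def le_iff_meet eq_is_equal)
      ultimately show ?thesis by (simp add: F_def)
    qed
    ultimately show ?thesis
      using sub refl[of \<top>] unfolding lattice_filter_def by (auto simp: F_def)
  qed
  \<comment> \<open>The conclusion says that \<open>a\<close> is below \<open>b\<close> modulo
    \<theta>.\<close>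
  have key: "(a, a \<sqinter> b) \<in> \<theta>"
    if a: "a \<in> carrier A" and b: "b \<in> carrier A"
      and imp: "\<And>P. P \<in> saturated_primes \<theta> \<Longrightarrow> a \<in> P \<Longrightarrow> b \<in> P" for a b
  proof -
    \<comment> \<open>Otherwise a prime filter contains \<open>F\<close> and \<open>a\<close> but
      not \<open>b\<close>. Containing the kernel \<open>F\<close> makes it saturated, against the
      assumption on \<open>a\<close> and \<open>b\<close>.\<close>
    have "b \<in> adjoin A F a"
    proof (rule ccontr)
      assume "b \<notin> adjoin A F a"
      then obtain P where P: "prime_filter A P" "adjoin A F a \<subseteq> P" "b \<notin> P"
        using prime_filter_separation[OF distrib adjoin(1)[OF F a] b] by blast
      then have "P \<in> saturated_primes \<theta>"
        using saturated_if_kernel_subset[OF \<theta>] adjoin(2)[OF F a] by (auto simp: F_def)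
      then show False using imp P adjoin(3)[OF F a] by auto
    qed
    then obtain e where e: "(e, \<top>) \<in> \<theta>" "e \<sqinter> a \<sqsubseteq> b"
      by (auto simp: adjoin_def F_def)
    then have ec: "e \<in> carrier A" using sub by auto
    have "(e \<sqinter> a, \<top> \<sqinter> a) \<in> \<theta>" using meet e refl a by blast
    then have 1: "(e \<sqinter> a, a) \<in> \<theta>"
      using top_meet[OF a] by (simp add: eq_is_equal)
    \<comment> \<open>Since \<open>e \<sqinter> a \<sqsubseteq> b\<close>, meeting the left entry
      with \<open>b\<close> leaves it unchanged.\<close>
    from meet[OF 1 refl[OF b]] have "(e \<sqinter> a, a \<sqinter> b) \<in> \<theta>"
      using e ec a b by (simp add: le_iff_join)
    then show ?thesis using 1 sym trans by blast
  qed
  show "Theta_M A (saturated_primes \<theta>) \<subseteq> \<theta>"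
  proof clarify
    fix a b assume "(a, b) \<in> Theta_M A (saturated_primes \<theta>)"
    then have c: "a \<in> carrier A" "b \<in> carrier A"
      and iff: "\<And>P. P \<in> saturated_primes \<theta> \<Longrightarrow> a \<in> P \<longleftrightarrow> b \<in> P"
      by (auto simp: Theta_M_def sigma_def saturated_primes_def)
    have "(a, a \<sqinter> b) \<in> \<theta>" "(b, a \<sqinter> b) \<in> \<theta>"
      using key[OF c] key[OF c(2,1)] iff by (auto simp: meet_comm)
    then show "(a, b) \<in> \<theta>" using sym trans by blast
  qed
qed

text \<open>A point \<open>P\<close> of \<open>Y\<close> outside the closed set \<open>Z\<close> has
  a basic neighbourhood \<open>sigma A a - sigma A b\<close> missing \<open>Z\<close>. Then
  \<open>a\<close> and \<open>a \<sqinter> b\<close> have the same trace on \<open>Z\<close>, while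
  \<open>P\<close> separates them on \<open>Y\<close>.\<close>

lemma Theta_M_subset_iff:
  assumes Y: "closedin (prime_filter_topology A) Y" and Z: "closedin (prime_filter_topology A) Z"
  shows "Theta_M A Z \<subseteq> Theta_M A Y \<longleftrightarrow> Y \<subseteq> Z"
proof
  assume sub: "Theta_M A Z \<subseteq> Theta_M A Y"
  show "Y \<subseteq> Z"
  proof (rule ccontr)
    assume "\<not> Y \<subseteq> Z"
    then obtain P where P: "P \<in> Y" "P \<notin> Z" by blast
    have "Y \<subseteq> prime_filters A" "openin (prime_filter_topology A) (prime_filters A - Z)"
      using Y Z by (auto simp: closedin_def topspace_prime_filter_topology)
    moreover have "P \<in> prime_filters A - Z" using P calculation by blast
    ultimately obtain a b where ab: "a \<in> carrier A" "b \<in> carrier A" "P \<in> sigma A a - sigma A b"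
      "sigma A a - sigma A b \<subseteq> prime_filters A - Z"
      using prime_filter_topology_basis by blast
    have "sigma A (a \<sqinter> b) = sigma A a \<inter> sigma A b"
      using ab(1,2) by (auto simp: sigma_def prime_filters_def prime_filter_mem)
    then have "(a, a \<sqinter> b) \<in> Theta_M A Z" "(a, a \<sqinter> b) \<notin> Theta_M A Y"
      using ab P by (auto simp: Theta_M_def)
    then show False using sub by blast
  qed
qed (auto simp: Theta_M_def)

text \<open>Injectivity follows because \<open>Theta_M\<close> reflects inclusion of closed sets;
  \<open>saturated_primes\<close> supplies the preimages.\<close>

lemma bij_betw_Theta_M:
  "bij_betw (Theta_M A) (carrier (closed_modal n A)) (carrier (Con n A))"
  unfolding bij_betw_def
proof
  show "inj_on (Theta_M A) (carrier (closed_modal n A))"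
    by (rule inj_onI) (simp add: closed_modal_def Theta_M_subset_iff[symmetric] set_eq_subset)
  have "\<theta> \<in> Theta_M A ` carrier (closed_modal n A)" if \<theta>: "congruence n A \<theta>" for \<theta>
    using Theta_M_saturated_primes[OF \<theta>] modal_saturated_primes[OF \<theta>] closedin_saturated_primes[of \<theta>] \<theta>
    by (intro image_eqI[of _ _ "saturated_primes \<theta>"])
      (auto simp: closed_modal_def congruence_def equiv_def)
  then show "Theta_M A ` carrier (closed_modal n A) = carrier (Con n A)"
    using congruence_Theta_M by (auto simp: Con_def closed_modal_def)
qed

section \<open>Open modal sets through complementation\<close>

lemma Theta_OM_eq:
  assumes "G \<subseteq> prime_filters A"
  shows "Theta_OM A G = Theta_M A (prime_filters A - G)"
  by (auto simp: Theta_OM_def Theta_M_def sigma_def)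

lemma modal_Diff:
  assumes "modal n A Y"
  shows "modal n A (prime_filters A - Y)"
proof -
  have spec: "spec_map A i P \<in> prime_filters A" if "P \<in> prime_filters A" "i \<in> {1..n - 1}" for i P
    using that by (simp add: prime_filters_def prime_filter_spec_map)
  have iff: "spec_map A i P \<in> Y \<longleftrightarrow> P \<in> Y" if "P \<in> prime_filters A" "i \<in> {1..n - 1}" for i P
    using assms that unfolding modal_def by blast
  show ?thesis
    unfolding modal_def by (intro conjI ballI set_eqI) (use spec iff in auto)
qed

lemma modal_Un_Int:
  assumes "modal n A Y" "modal n A Z"
  shows "modal n A (Y \<union> Z)" "modal n A (Y \<inter> Z)"
  using assms unfolding modal_def by blast+

lemma bij_betw_complement:
  "bij_betw (\<lambda>G. prime_filters A - G) (carrier (open_modal n A)) (carrier (closed_modal n A))"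
proof (rule bij_betw_byWitness)
  note top = topspace_prime_filter_topology
  show "\<forall>G\<in>carrier (open_modal n A). prime_filters A - (prime_filters A - G) = G"
    "\<forall>Y\<in>carrier (closed_modal n A). prime_filters A - (prime_filters A - Y) = Y"
    by (simp_all add: open_modal_def closed_modal_def modal_def double_diff)
  have "closedin (prime_filter_topology A) (prime_filters A - G)"
    if "openin (prime_filter_topology A) G" for G
    using closedin_diff[OF closedin_topspace that] by (simp add: top)
  then show "(\<lambda>G. prime_filters A - G) ` carrier (open_modal n A) \<subseteq> carrier (closed_modal n A)"
    by (intro image_subsetI) (simp add: open_modal_def closed_modal_def modal_Diff)
  have "openin (prime_filter_topology A) (prime_filters A - Y)"
    if "closedin (prime_filter_topology A) Y" for Y
    using openin_diff[OF openin_topspace that] by (simp add: top)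
  then show "(\<lambda>Y. prime_filters A - Y) ` carrier (closed_modal n A) \<subseteq> carrier (open_modal n A)"
    by (intro image_subsetI) (simp add: open_modal_def closed_modal_def modal_Diff)
qed

end

section \<open>The two lattice isomorphisms\<close>

theorem theorem3p13:
  fixes A :: "('a, 'm) lm_struct_scheme" and n :: nat
  assumes "n \<ge> 2" and "lm_algebra A n"
  shows "lattice_iso (closed_modal n A) (inv_gorder (Con n A)) (Theta_M A)
    \<and> lattice_iso (open_modal n A) (Con n A) (Theta_OM A)"
proof
  interpret lm_algebra A n by fact
  interpret Con: partial_order "Con n A"
    unfolding Con_def by (rule partial_order_inclusion_order)
  have lat: "lattice (closed_modal n A)" "lattice (open_modal n A)"
    unfolding closed_modal_def open_modal_def
    by (rule lattice_inclusion_order; simp add: modal_Un_Int closedin_Un closedin_Int openin_Un openin_Int)+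
  have closed_le: "Y \<subseteq> Z \<longleftrightarrow> Theta_M A Z \<subseteq> Theta_M A Y"
    if "Y \<in> carrier (closed_modal n A)" "Z \<in> carrier (closed_modal n A)" for Y Z
    using that Theta_M_subset_iff by (auto simp: closed_modal_def)
  show "lattice_iso (closed_modal n A) (inv_gorder (Con n A)) (Theta_M A)"
  proof (rule lattice_isoI)
    show "bij_betw (Theta_M A) (carrier (closed_modal n A)) (carrier (inv_gorder (Con n A)))"
      using bij_betw_Theta_M by simp
    show "Y \<sqsubseteq>\<^bsub>closed_modal n A\<^esub> Z \<longleftrightarrow> Theta_M A Y \<sqsubseteq>\<^bsub>inv_gorder (Con n A)\<^esub> Theta_M A Z"
      if "Y \<in> carrier (closed_modal n A)" "Z \<in> carrier (closed_modal n A)" for Y Z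
      using closed_le[OF that] by (simp add: closed_modal_def Con_def)
  qed (use lat Con.dual_order in auto)
  have open_sub: "G \<subseteq> prime_filters A" if "G \<in> carrier (open_modal n A)" for G
    using that by (simp add: open_modal_def modal_def)
  show "lattice_iso (open_modal n A) (Con n A) (Theta_OM A)"
  proof (rule lattice_isoI)
    show "bij_betw (Theta_OM A) (carrier (open_modal n A)) (carrier (Con n A))"
      \<comment> \<open>On open modal sets \<open>Theta_OM\<close> is complementation followed by
        \<open>Theta_M\<close>.\<close>
      using bij_betw_trans[OF bij_betw_complement bij_betw_Theta_M]
      by (rule bij_betw_cong[THEN iffD1, rotated]) (simp add: Theta_OM_eq open_sub)
    show "G \<sqsubseteq>\<^bsub>open_modal n A\<^esub> H \<longleftrightarrow> Theta_OM A G \<sqsubseteq>\<^bsub>Con n A\<^esub> Theta_OM A H"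
      if "G \<in> carrier (open_modal n A)" "H \<in> carrier (open_modal n A)" for G H
    proof -
      \<comment> \<open>Complementation and \<open>Theta_M\<close> both reverse inclusion, so their
        composite preserves it.\<close>
      have "G \<subseteq> H \<longleftrightarrow> prime_filters A - H \<subseteq> prime_filters A - G"
        using open_sub that by blast
      also have "\<dots> \<longleftrightarrow> Theta_M A (prime_filters A - G) \<subseteq> Theta_M A (prime_filters A - H)"
        using closed_le bij_betw_complement that by (meson bij_betwE)
      finally show ?thesis
        using open_sub that by (simp add: open_modal_def Con_def Theta_OM_eq)
    qed
  qed (use lat Con.partial_order_axioms in auto)
qed

end
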